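(* Let $D_0=\{0,1\}$ and, for $k\ge0$, let $u_k$ be the concatenation of all words of $D_k$ listed in lexicographic order (with $0<1$), and $D_{k+1}=u_kD_k^2=\{u_kw_1w_2: w_1,w_2\in D_k\}$. The sequence $(u_k)_{k\ge0}$ converges to an infinite word $\mathbf{u}=0100010101100111\cdots$. The abelian complexity of $\mathbf{u}$ is unbounded and $b^{(k)}_{\mathbf{u}}\prec b^{(k+1)}_{\mathbf{u}}$ for all $k\ge1$.
   Context: For words $u,w$, $\binom{u}{w}$ is the number of occurrences of $w$ as a scattered subword of $u$; $u\sim_k v$ if $\binom{u}{x}=\binom{v}{x}$ for all words $x$ of length at most $k$. $b^{(k)}_{\mathbf{x}}(n)$ is the number of $\sim_k$-classes among length-$n$ factors of $\mathbf{x}$ (for $k=1$, the abelian complexity). For $f,g\colon\mathbb{N}\to\mathbb{N}$, $f\prec g$ means $f(n)<g(n)$ for infinitely many $n$. *)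

theory Defs
  imports "HOL-Library.Omega_Words_Fun" "HOL-Library.List_Lexorder"
begin

text \<open>Finite words are lists, infinite words are functions on \<open>nat\<close>; the order on lists is
  the lexicographic one.\<close>

text \<open>An occurrence of \<open>w\<close> as a scattered subword of \<open>u\<close> is a set of positions of \<open>u\<close>
  whose letters, read from left to right, spell \<open>w\<close>.\<close>

definition word_binom :: "'a list \<Rightarrow> 'a list \<Rightarrow> nat" where
  "word_binom u w = card {I. I \<subseteq> {..<length u} \<and> nths u I = w}"

definition binom_equiv :: "nat \<Rightarrow> 'a list \<Rightarrow> 'a list \<Rightarrow> bool" where
  "binom_equiv k u v \<longleftrightarrow> (\<forall>x. length x \<le> k \<longrightarrow> word_binom u x = word_binom v x)"

definition factors :: "(nat \<Rightarrow> 'a) \<Rightarrow> nat \<Rightarrow> 'a list set" where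
  "factors x n = {x [i \<rightarrow> i + n] | i. True}"

definition binom_complexity :: "nat \<Rightarrow> (nat \<Rightarrow> 'a) \<Rightarrow> nat \<Rightarrow> nat" where
  "binom_complexity k x n = card (factors x n // {(u, v). binom_equiv k u v})"

abbreviation abelian_complexity :: "(nat \<Rightarrow> 'a) \<Rightarrow> nat \<Rightarrow> nat" where
  "abelian_complexity \<equiv> binom_complexity 1"

definition inf_often_less :: "(nat \<Rightarrow> nat) \<Rightarrow> (nat \<Rightarrow> nat) \<Rightarrow> bool" (infix \<open>\<prec>\<close> 50) where
  "f \<prec> g \<longleftrightarrow> infinite {n. f n < g n}"

text \<open>Convergence of finite words to an infinite word: every prefix of the limit is eventually
  a prefix of the members of the sequence (in particular their lengths tend to infinity).\<close>

definition words_converge :: "(nat \<Rightarrow> 'a list) \<Rightarrow> (nat \<Rightarrow> 'a) \<Rightarrow> bool" where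
  "words_converge s x \<longleftrightarrow>
     (\<forall>n. \<exists>K. \<forall>k\<ge>K. n \<le> length (s k) \<and> take n (s k) = x [0 \<rightarrow> n])"

definition lex_concat :: "'a::linorder list set \<Rightarrow> 'a list" where
  "lex_concat A = concat (sorted_list_of_set A)"

primrec D_seq :: "nat \<Rightarrow> nat list set" where
  "D_seq 0 = {[0], [1]}"
| "D_seq (Suc k) = {lex_concat (D_seq k) @ w1 @ w2 | w1 w2. w1 \<in> D_seq k \<and> w2 \<in> D_seq k}"

text \<open>\<open>sorted_list_of_set\<close> is meaningful on finite sets only.\<close>

lemma finite_D_seq: "finite (D_seq k)"
proof (induction k)
  case (Suc k)
  have "D_seq (Suc k) = (\<lambda>(w1, w2). lex_concat (D_seq k) @ w1 @ w2) ` (D_seq k \<times> D_seq k)"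
    by auto
  with Suc show ?case by simp
qed simp

definition u_seq :: "nat \<Rightarrow> nat list" where
  "u_seq k = lex_concat (D_seq k)"

text \<open>A sequence of words has at most one limit.\<close>

definition u_lim :: "nat \<Rightarrow> nat" where
  "u_lim = (THE x. words_converge u_seq x)"

end

theory Submission
  imports Defs "HOL-Library.Sublist"
begin

text \<open>
  If \<open>v \<sim>\<^sub>k w\<close>, then \<open>vw \<sim>\<^bsub>k+1\<^esub> wv\<close>; and if in addition \<open>k \<ge> 1\<close> and \<open>v\<close>, \<open>w\<close> are not
  \<open>(k+1)\<close>-equivalent, then \<open>vw\<close> and \<open>wv\<close> are not \<open>(k+2)\<close>-equivalent. Since a common prefix is
  irrelevant for binomial equivalence, a pair in \<open>D\<^sub>k\<close> separating \<open>\<sim>\<^sub>k\<close> from \<open>\<sim>\<^bsub>k+1\<^esub>\<close> thus yields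
  the pair \<open>u\<^sub>kvw\<close>, \<open>u\<^sub>kwv\<close> in \<open>D\<^bsub>k+1\<^esub>\<close> separating the next two relations, while \<open>u\<^sub>kvv\<close>, \<open>u\<^sub>kvw\<close>
  separates the same relations as before at a greater length. All words of \<open>D\<^sub>j\<close> have the same
  length and are factors of the limit, so each strict inequality of complexities holds for
  infinitely many lengths. The numbers of ones in words of \<open>D\<^sub>j\<close> contain an interval that grows with
  \<open>j\<close>, whence the unbounded abelian complexity.
\<close>

section \<open>Binomial coefficients of words\<close>

lemma word_binom_Nil_right [simp]: "word_binom u [] = 1"
proof -
  have "I = {}" if "I \<subseteq> {..<length u}" "nths u I = []" for I
    using that set_nths[of u I] by auto
  then have "{I. I \<subseteq> {..<length u} \<and> nths u I = []} = {{}}" by auto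
  then show ?thesis by (simp add: word_binom_def)
qed

lemma word_binom_Nil_Cons [simp]: "word_binom [] (b # w) = 0"
  by (simp add: word_binom_def)

text \<open>Pascal-type recursion: occurrences are split by whether they use position 0, which is
  possible only if \<open>a = b\<close>.\<close>

lemma word_binom_Cons_Cons [simp]:
  "word_binom (a # u) (b # w) = word_binom u (b # w) + (if a = b then word_binom u w else 0)"
proof -
  let ?S = "\<lambda>u w. {I. I \<subseteq> {..<length u} \<and> nths u I = w}"
  have fin: "finite (?S u w)" for u :: "'a list" and w
    by (rule finite_subset[of _ "Pow {..<length u}"]) auto
  \<comment> \<open>Empty when the letters differ, so one disjoint union covers both cases.\<close>
  define P where "P = (if a = b then ?S u w else {})"
  have inj: "inj (image Suc)" "inj_on (\<lambda>J. insert 0 (Suc ` J)) X" for X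
    by (auto simp: inj_on_def inj_image_eq_iff insert_ident)
  have split_eq: "?S (a # u) (b # w) = image Suc ` ?S u (b # w) \<union> (\<lambda>J. insert 0 (Suc ` J)) ` P"
    (is "?L = ?R1 \<union> ?R2")
  proof (intro equalityI subsetI)
    fix I assume I: "I \<in> ?L"
    define J where "J = {j. Suc j \<in> I}"
    have IJ: "I = (if 0 \<in> I then insert 0 (Suc ` J) else Suc ` J)"
      unfolding J_def by (auto simp: image_iff) (metis not0_implies_Suc)+
    have J: "J \<subseteq> {..<length u}" using I by (auto simp: J_def)
    have n: "(if 0 \<in> I then [a] else []) @ nths u J = b # w"
      using I by (simp add: nths_Cons J_def)
    show "I \<in> ?R1 \<union> ?R2"
    proof (cases "0 \<in> I")
      case True
      then have "J \<in> P" using n J by (auto simp: P_def)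
      then show ?thesis using True IJ by auto
    next
      case False
      then have "J \<in> ?S u (b # w)" using n J by auto
      then show ?thesis using False IJ by auto
    qed
  next
    fix I assume "I \<in> ?R1 \<union> ?R2"
    then show "I \<in> ?L"
      by (auto simp: nths_Cons P_def inj_image_mem_iff split: if_splits)
  qed
  have "card ?L = card ?R1 + card ?R2"
    unfolding split_eq by (rule card_Un_disjoint) (auto simp: fin P_def)
  also have "\<dots> = card (?S u (b # w)) + card P"
    using inj by (simp add: card_image inj_on_subset)
  finally show ?thesis by (simp add: word_binom_def P_def)
qed

text \<open>Vandermonde-type identity: the seam cuts an occurrence of \<open>x\<close> into a prefix
  of \<open>x\<close> found in \<open>u\<close> and the remaining suffix found in
  \<open>v\<close>.\<close>

lemma word_binom_append:
  "word_binom (u @ v) x = (\<Sum>i\<le>length x. word_binom u (take i x) * word_binom v (drop i x))"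
proof (induction u arbitrary: x)
  case Nil
  show ?case
  proof (cases x)
    case (Cons b w)
    then show ?thesis by (simp add: sum.atMost_Suc_shift del: sum.atMost_Suc)
  qed simp
next
  case (Cons a u)
  show ?case
  proof (cases x)
    case (Cons b w)
    show ?thesis
      using Cons.IH[of x] Cons.IH[of w] unfolding Cons
      by (simp add: sum.atMost_Suc_shift sum.distrib algebra_simps del: sum.atMost_Suc)
  qed simp
qed

lemma word_binom_singleton: "word_binom u [a] = count_list u a"
  by (induction u) auto

lemma word_binom_replicate: "word_binom u (replicate m a) = count_list u a choose m"
proof (induction u arbitrary: m)
  case Nil
  show ?case by (cases m) auto
next
  case (Cons b u)
  show ?case
  proof (cases m)
    case (Suc m')
    then show ?thesis using Cons.IH[of m] Cons.IH[of m'] by simp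
  qed simp
qed

section \<open>Binomial equivalence\<close>

lemma binom_equivD: "binom_equiv k u v \<Longrightarrow> length x \<le> k \<Longrightarrow> word_binom u x = word_binom v x"
  by (simp add: binom_equiv_def)

text \<open>In the expansion over splits of \<open>x\<close>, the term for the empty prefix is the
  coefficient of \<open>x\<close> itself. All other terms involve shorter suffixes, so cancellation
  follows by induction on the length.\<close>

lemma binom_equiv_append_left_iff: "binom_equiv k (u @ v) (u @ w) \<longleftrightarrow> binom_equiv k v w"
proof
  assume "binom_equiv k v w"
  then show "binom_equiv k (u @ v) (u @ w)"
    by (auto simp: binom_equiv_def word_binom_append intro!: sum.cong)
next
  assume uvw: "binom_equiv k (u @ v) (u @ w)"
  have "word_binom v x = word_binom w x" if "length x \<le> k" for x
    using that
  proof (induction x rule: length_induct)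
    case (1 x)
    let ?f = "\<lambda>v i. word_binom u (take i x) * word_binom v (drop i x)"
    have eq: "word_binom (u @ v) x = word_binom v x + (\<Sum>i\<in>{1..length x}. ?f v i)" for v
      unfolding word_binom_append
      by (simp add: atMost_atLeast0 sum.atLeast_Suc_atMost[of 0])
    have "(\<Sum>i\<in>{1..length x}. ?f v i) = (\<Sum>i\<in>{1..length x}. ?f w i)"
      using 1 by (intro sum.cong) auto
    then show ?case
      using binom_equivD[OF uvw] 1(2) eq[of v] eq[of w] by simp
  qed
  then show "binom_equiv k v w" by (simp add: binom_equiv_def)
qed

text \<open>The two splits with an empty piece cancel each other, so only splits into nonempty
  pieces remain.\<close>

lemma binom_commutator_eq:
  fixes u v x :: "'a list"
  defines "f \<equiv> \<lambda>i. int (word_binom u (take i x)) * int (word_binom v (drop i x))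
      - int (word_binom v (take i x)) * int (word_binom u (drop i x))"
  shows "int (word_binom (u @ v) x) - int (word_binom (v @ u) x) = (\<Sum>i=1..<length x. f i)"
proof -
  have "int (word_binom (u @ v) x) - int (word_binom (v @ u) x) = (\<Sum>i\<le>length x. f i)"
    by (simp add: word_binom_append f_def sum_subtractf)
  also have "\<dots> = (\<Sum>i=1..<length x. f i)"
  proof (cases "length x")
    case (Suc n)
    have "(\<Sum>i\<le>Suc n. f i) = f 0 + (\<Sum>i=1..<Suc n. f i) + f (Suc n)"
      by (simp add: atMost_atLeast0 sum.atLeast_Suc_atMost[of 0] atLeastLessThanSuc_atLeastAtMost)
    moreover have "f 0 + f (Suc n) = 0" using Suc by (simp add: f_def)
    ultimately show ?thesis using Suc by simp
  qed (simp add: f_def)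
  finally show ?thesis .
qed

text \<open>Nonempty pieces of a word of length at most \<open>k + 1\<close> have length at most
  \<open>k\<close>; there \<open>u\<close> and \<open>v\<close> agree and every term
  vanishes.\<close>

lemma binom_equiv_commute:
  assumes "binom_equiv k u v"
  shows "binom_equiv (Suc k) (u @ v) (v @ u)"
  unfolding binom_equiv_def
proof (intro allI impI)
  fix x :: "'a list" assume "length x \<le> Suc k"
  then have "int (word_binom (u @ v) x) - int (word_binom (v @ u) x) = 0"
    unfolding binom_commutator_eq
    by (intro sum.neutral) (auto simp: binom_equivD[OF assms])
  then show "word_binom (u @ v) x = word_binom (v @ u) x" by simp
qed

text \<open>
  Let \<open>\<delta> y\<close> be the difference of the coefficients of \<open>y\<close> in \<open>u\<close> and \<open>v\<close>. Were the commuted products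
  equivalent, then for a letter \<open>a\<close> of \<open>u\<close> and \<open>\<delta> (c # z) \<noteq> 0\<close> with \<open>length z = k\<close> one would get
  \<open>\<delta> (z @ [a]) \<noteq> 0\<close>. Iterating this ends at \<open>\<delta> (a\<^bsup>k+1\<^esup>) \<noteq> 0\<close>, but the coefficient of a power of \<open>a\<close>
  depends only on the number of occurrences of \<open>a\<close>.
\<close>

lemma not_binom_equiv_commute:
  assumes equ: "binom_equiv k u v" and nequ: "\<not> binom_equiv (Suc k) u v"
    and "k \<ge> 1" and "u \<noteq> []"
  shows "\<not> binom_equiv (Suc (Suc k)) (u @ v) (v @ u)"
proof
  assume comm: "binom_equiv (Suc (Suc k)) (u @ v) (v @ u)"
  define \<delta> where "\<delta> y = int (word_binom u y) - int (word_binom v y)" for y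
  obtain y where y: "length y = Suc k" "\<delta> y \<noteq> 0"
    using equ nequ unfolding binom_equiv_def \<delta>_def by (metis le_Suc_eq of_nat_eq_iff right_minus_eq)
  define a where "a = hd u"
  have count: "count_list v c = count_list u c" for c
    using binom_equivD[OF equ, of "[c]"] \<open>k \<ge> 1\<close> by (simp add: word_binom_singleton)
  have a_pos: "count_list u a > 0"
    using \<open>u \<noteq> []\<close> count_list_0_iff[of u a] by (simp add: a_def)
  have shift: "\<delta> (c # z) * int (count_list u a) = int (count_list u c) * \<delta> (z @ [a])"
    if "length z = k" for c z
  proof -
    let ?x = "c # z @ [a]"
    let ?f = "\<lambda>i. int (word_binom u (take i ?x)) * int (word_binom v (drop i ?x))
      - int (word_binom v (take i ?x)) * int (word_binom u (drop i ?x))"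
    have "0 = (\<Sum>i=1..<length ?x. ?f i)"
      unfolding binom_commutator_eq[symmetric] using binom_equivD[OF comm, of ?x] that by simp
    \<comment> \<open>As \<open>?x\<close> has length \<open>k + 2\<close>, all other splits have
      both pieces of length at most \<open>k\<close> and contribute 0.\<close>
    also have "\<dots> = (\<Sum>i\<in>{1, Suc k}. ?f i)"
      using that \<open>k \<ge> 1\<close>
      by (intro sum.mono_neutral_right ballI) (auto simp: binom_equivD[OF equ])
    also have "\<dots> = ?f 1 + ?f (Suc k)" using \<open>k \<ge> 1\<close> by simp
    also have "?f 1 = - int (count_list u c) * \<delta> (z @ [a])"
      by (simp add: word_binom_singleton count \<delta>_def algebra_simps del: word_binom_Cons_Cons)
    also have "?f (Suc k) = \<delta> (c # z) * int (count_list u a)"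
      using that by (simp add: word_binom_singleton count \<delta>_def algebra_simps)
    finally show ?thesis by simp
  qed
  have "\<delta> (drop i y @ replicate i a) \<noteq> 0" if "i \<le> Suc k" for i
    using that
  proof (induction i)
    case (Suc i)
    let ?z = "drop (Suc i) y @ replicate i a"
    have "drop i y @ replicate i a = y ! i # ?z"
      using Suc.prems y(1) by (simp add: Cons_nth_drop_Suc)
    moreover have "length ?z = k" using Suc.prems y(1) by simp
    ultimately have "\<delta> (?z @ [a]) \<noteq> 0"
      using Suc shift[of ?z "y ! i"] a_pos by auto
    then show ?case by (simp add: replicate_append_same)
  qed (simp add: y)
  from this[of "Suc k"] have "\<delta> (replicate (Suc k) a) \<noteq> 0" using y(1) by simp
  then show False by (simp add: \<delta>_def word_binom_replicate count del: replicate_Suc)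
qed

section \<open>Binomial complexity\<close>

lemma quotient_binom_equiv:
  "X // {(u, v). binom_equiv k u v} = (\<lambda>u. Collect (binom_equiv k u)) ` X"
  by (auto simp: quotient_def)

lemma Collect_binom_equiv_eq_iff:
  "Collect (binom_equiv k u) = Collect (binom_equiv k v) \<longleftrightarrow> binom_equiv k u v"
  unfolding set_eq_iff mem_Collect_eq by (auto simp: binom_equiv_def)

lemma finite_factors: "finite (range x) \<Longrightarrow> finite (factors x n)"
  by (rule finite_subset[OF _ finite_lists_length_eq[of "range x" n]]) (auto simp: factors_def subsequence_def)

text \<open>Classes of order \<open>k + 1\<close> refine those of order \<open>k\<close>, and the
  pair \<open>u\<close>, \<open>v\<close> makes two of them merge.\<close>

lemma binom_complexity_less:
  assumes fin: "finite (range x)" and uv: "u \<in> factors x n" "v \<in> factors x n"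
    and "binom_equiv k u v" "\<not> binom_equiv (Suc k) u v"
  shows "binom_complexity k x n < binom_complexity (Suc k) x n"
proof -
  let ?F = "factors x n" and ?C = "\<lambda>k u. Collect (binom_equiv k u)"
  \<comment> \<open>Sends a class of order \<open>k + 1\<close> to the class of order
    \<open>k\<close> containing it, without choosing a representative.\<close>
  define g where "g X = (\<Union>w\<in>X. ?C k w)" for X :: "'a list set"
  have g: "g (?C (Suc k) w) = ?C k w" for w
    unfolding g_def by (auto simp: binom_equiv_def)
  have img: "?C k ` ?F = g ` ?C (Suc k) ` ?F" by (simp add: image_image g)
  have "\<not> inj_on g (?C (Suc k) ` ?F)"
  proof
    assume "inj_on g (?C (Suc k) ` ?F)"
    moreover have "g (?C (Suc k) u) = g (?C (Suc k) v)"
      using assms by (simp add: g Collect_binom_equiv_eq_iff)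
    ultimately have "?C (Suc k) u = ?C (Suc k) v" using uv by (simp add: inj_on_eq_iff)
    then show False using assms by (simp add: Collect_binom_equiv_eq_iff)
  qed
  then have "card (g ` ?C (Suc k) ` ?F) < card (?C (Suc k) ` ?F)"
    using finite_factors[OF fin] by (meson card_image_le eq_card_imp_inj_on finite_imageI nat_less_le)
  then show ?thesis by (simp add: binom_complexity_def quotient_binom_equiv img)
qed

lemma abelian_complexity_ge:
  assumes fin: "finite (range x)" and M: "M \<subseteq> (\<lambda>u. count_list u a) ` factors x n"
  shows "card M \<le> abelian_complexity x n"
proof -
  obtain W where W: "\<And>m. m \<in> M \<Longrightarrow> W m \<in> factors x n \<and> count_list (W m) a = m"
    using bchoice[of M "\<lambda>m u. u \<in> factors x n \<and> count_list u a = m"] M by blast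
  let ?C = "\<lambda>u. Collect (binom_equiv 1 u)"
  have "inj_on (\<lambda>m. ?C (W m)) M"
  proof (rule inj_onI)
    fix m m' assume "m \<in> M" "m' \<in> M" "?C (W m) = ?C (W m')"
    then show "m = m'"
      using binom_equivD[of 1 "W m" "W m'" "[a]"] W
      by (simp add: Collect_binom_equiv_eq_iff word_binom_singleton)
  qed
  moreover have "(\<lambda>m. ?C (W m)) ` M \<subseteq> ?C ` factors x n" using W by auto
  ultimately have "card M \<le> card (?C ` factors x n)"
    using finite_factors[OF fin] by (intro card_inj_on_le) auto
  then show ?thesis by (simp add: binom_complexity_def quotient_binom_equiv)
qed

section \<open>The words \<open>u\<^sub>k\<close> and their limit\<close>

lemma D_seq_Suc: "D_seq (Suc k) = {u_seq k @ w1 @ w2 | w1 w2. w1 \<in> D_seq k \<and> w2 \<in> D_seq k}"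
  by (simp add: u_seq_def)

lemma D_seq_SucI: "v \<in> D_seq k \<Longrightarrow> w \<in> D_seq k \<Longrightarrow> u_seq k @ v @ w \<in> D_seq (Suc k)"
  unfolding D_seq_Suc by blast

declare D_seq.simps(2) [simp del]

lemma set_u_seq: "set (u_seq k) = \<Union> (set ` D_seq k)"
  by (simp add: u_seq_def lex_concat_def finite_D_seq)

lemma D_seq_nonempty: "D_seq k \<noteq> {}"
  by (induction k) (auto simp: D_seq_Suc)

lemma D_seq_letters: "w \<in> D_seq k \<Longrightarrow> set w \<subseteq> {0, 1}"
proof (induction k arbitrary: w)
  case (Suc k)
  have "set (u_seq k) \<subseteq> {0, 1}" unfolding set_u_seq using Suc.IH by blast
  moreover obtain w1 w2 where "w = u_seq k @ w1 @ w2" "w1 \<in> D_seq k" "w2 \<in> D_seq k"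
    using Suc.prems unfolding D_seq_Suc by blast
  ultimately show ?case using Suc.IH[of w1] Suc.IH[of w2] by simp
qed auto

lemma u_seq_letters: "set (u_seq k) \<subseteq> {0, 1}"
  unfolding set_u_seq using D_seq_letters by blast

lemma sublist_u_seq: "w \<in> D_seq k \<Longrightarrow> sublist w (u_seq k)"
proof -
  assume "w \<in> D_seq k"
  then have "w \<in> set (sorted_list_of_set (D_seq k))" by (simp add: finite_D_seq)
  then obtain ys zs where "sorted_list_of_set (D_seq k) = ys @ w # zs" by (meson split_list)
  then show ?thesis by (simp add: u_seq_def lex_concat_def)
qed

lemma D_seq_length_eq: "v \<in> D_seq k \<Longrightarrow> w \<in> D_seq k \<Longrightarrow> length v = length w"
proof (induction k arbitrary: v w)
  case (Suc k)
  from Suc.prems obtain v1 v2 w1 w2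
    where v: "v = u_seq k @ v1 @ v2" "v1 \<in> D_seq k" "v2 \<in> D_seq k"
      and w: "w = u_seq k @ w1 @ w2" "w1 \<in> D_seq k" "w2 \<in> D_seq k"
    unfolding D_seq_Suc by blast
  then show ?case using Suc.IH[of v1 w1] Suc.IH[of v2 w2] by simp
qed auto

lemma D_seq_length_gt: "w \<in> D_seq k \<Longrightarrow> k < length w"
proof (induction k arbitrary: w)
  case (Suc k)
  from Suc.prems obtain w1 w2 where w: "w = u_seq k @ w1 @ w2" "w1 \<in> D_seq k" "w2 \<in> D_seq k"
    unfolding D_seq_Suc by blast
  then show ?case using Suc.IH[of w1] Suc.IH[of w2] by simp
qed auto

lemma u_seq_length_gt: "k < length (u_seq k)"
proof -
  obtain w where "w \<in> D_seq k" using D_seq_nonempty by blast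
  then show ?thesis
    using D_seq_length_gt[of w k] sublist_length_le[OF sublist_u_seq, of w k] by simp
qed

text \<open>The concatenation starts with the least word of \<open>D_seq (Suc k)\<close>, and every
  word there starts with \<open>u_seq k\<close>.\<close>

lemma prefix_u_seq_Suc: "Sublist.prefix (u_seq k) (u_seq (Suc k))"
proof -
  have "sorted_list_of_set (D_seq (Suc k)) \<noteq> []"
    using D_seq_nonempty finite_D_seq by (metis set_empty2 set_sorted_list_of_set)
  then obtain w ws where ws: "sorted_list_of_set (D_seq (Suc k)) = w # ws"
    by (meson list.exhaust)
  then have "w \<in> D_seq (Suc k)"
    by (metis finite_D_seq list.set_intros(1) set_sorted_list_of_set)
  then have "Sublist.prefix (u_seq k) w" unfolding D_seq_Suc by auto
  then show ?thesis using ws by (simp add: u_seq_def[of "Suc k"] lex_concat_def)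
qed

lemma prefix_u_seq: "j \<le> k \<Longrightarrow> Sublist.prefix (u_seq j) (u_seq k)"
  by (induction k rule: dec_induct) (auto intro: prefix_order.trans prefix_u_seq_Suc)

section \<open>The limit word and its factors\<close>

lemma words_converge_unique:
  assumes "words_converge s x" "words_converge s y"
  shows "x = y"
proof
  fix n
  obtain K where K: "\<forall>k\<ge>K. take (Suc n) (s k) = x [0 \<rightarrow> Suc n]"
    using assms(1) unfolding words_converge_def by meson
  obtain L where L: "\<forall>k\<ge>L. take (Suc n) (s k) = y [0 \<rightarrow> Suc n]"
    using assms(2) unfolding words_converge_def by meson
  have "x [0 \<rightarrow> Suc n] = y [0 \<rightarrow> Suc n]"
    using K L by (metis nat_le_linear)
  then show "x n = y n" by (simp add: subsequence_def)
qed

lemma words_converge_u_lim: "words_converge u_seq u_lim"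
proof -
  \<comment> \<open>Letter \<open>n\<close> exists in \<open>u_seq n\<close> because its length
    exceeds \<open>n\<close>, and the prefix chain fixes it from then on.\<close>
  define x where "x n = u_seq n ! n" for n
  have nth: "u_seq k ! i = x i" if "i \<le> k" for i k
    using prefix_u_seq[OF that] u_seq_length_gt[of i] by (auto simp: x_def prefix_def nth_append)
  have "n \<le> length (u_seq k) \<and> take n (u_seq k) = x [0 \<rightarrow> n]" if "n \<le> k" for n k
    using u_seq_length_gt[of k] that by (auto intro!: nth_equalityI simp: nth)
  then have x: "words_converge u_seq x" unfolding words_converge_def by blast
  show ?thesis
    unfolding u_lim_def
  proof (rule theI[of "words_converge u_seq", OF x])
    fix y assume "words_converge u_seq y"
    then show "y = x" using x by (rule words_converge_unique)
  qed
qed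

lemma u_seq_eq_prefix_u_lim: "u_seq k = u_lim [0 \<rightarrow> length (u_seq k)]"
proof -
  let ?n = "length (u_seq k)"
  from words_converge_u_lim obtain K where K: "\<forall>j\<ge>K. take ?n (u_seq j) = u_lim [0 \<rightarrow> ?n]"
    unfolding words_converge_def by meson
  have "Sublist.prefix (u_seq k) (u_seq (max k K))" by (simp add: prefix_u_seq)
  then have "take ?n (u_seq (max k K)) = u_seq k" by (auto simp: prefix_def)
  then show ?thesis using K by simp
qed

lemma finite_range_u_lim: "finite (range u_lim)"
proof -
  have "u_lim n \<in> {0, 1}" for n
  proof -
    have "u_seq n ! n = u_lim n"
      using u_seq_length_gt[of n] by (subst u_seq_eq_prefix_u_lim) simp
    then show ?thesis using u_seq_letters[of n] nth_mem[OF u_seq_length_gt[of n]] by auto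
  qed
  then have "range u_lim \<subseteq> {0, 1}" by (rule image_subsetI)
  then show ?thesis by (rule finite_subset) simp
qed

lemma sublist_subsequence_factor:
  assumes "sublist w (x [0 \<rightarrow> n])"
  shows "w \<in> factors x (length w)"
proof -
  obtain p q where pq: "x [0 \<rightarrow> n] = p @ w @ q"
    using assms by (auto simp: sublist_def)
  have n: "n = length p + length w + length q"
    using arg_cong[OF pq, of length] by simp
  have "w = x [length p \<rightarrow> length p + length w]"
  proof (rule nth_equalityI)
    fix i assume i: "i < length w"
    have "w ! i = (x [0 \<rightarrow> n]) ! (length p + i)"
      unfolding pq using i by (simp add: nth_append)
    then show "w ! i = x [length p \<rightarrow> length p + length w] ! i"
      using i n by simp
  qed simp
  then show ?thesis unfolding factors_def by blast
qed

lemma D_seq_subset_factors: "w \<in> D_seq k \<Longrightarrow> w \<in> factors u_lim (length w)"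
  using sublist_u_seq[of w k] sublist_subsequence_factor[of w u_lim "length (u_seq k)"]
  by (simp flip: u_seq_eq_prefix_u_lim)

section \<open>Pairs separating consecutive binomial equivalences\<close>

lemma D_seq_binom_pair_step:
  assumes "v \<in> D_seq j" "w \<in> D_seq j" "binom_equiv k v w" "\<not> binom_equiv (Suc k) v w"
  shows "\<exists>v\<in>D_seq (Suc j). \<exists>w\<in>D_seq (Suc j). binom_equiv k v w \<and> \<not> binom_equiv (Suc k) v w"
proof (intro bexI conjI)
  show "u_seq j @ v @ w \<in> D_seq (Suc j)" "u_seq j @ v @ v \<in> D_seq (Suc j)"
    using assms by (simp_all add: D_seq_SucI)
qed (use assms in \<open>simp_all add: binom_equiv_append_left_iff\<close>)

lemma D_seq_binom_pair_diagonal: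
  "\<exists>v\<in>D_seq (Suc k). \<exists>w\<in>D_seq (Suc k).
     binom_equiv (Suc k) v w \<and> \<not> binom_equiv (Suc (Suc k)) v w"
proof (induction k)
  case 0
  show ?case
  proof (intro bexI conjI)
    show "u_seq 0 @ [1] @ [0] \<in> D_seq (Suc 0)" "u_seq 0 @ [0] @ [1] \<in> D_seq (Suc 0)"
      by (rule D_seq_SucI; simp)+
    have "binom_equiv 0 [0::nat] [1]" by (simp add: binom_equiv_def)
    then show "binom_equiv (Suc 0) (u_seq 0 @ [0] @ [1]) (u_seq 0 @ [1] @ [0])"
      unfolding binom_equiv_append_left_iff by (rule binom_equiv_commute)
    \<comment> \<open>\<open>not_binom_equiv_commute\<close> starts at order 1, so the base case
      compares the coefficients of \<open>[0, 1]\<close> directly: 1 against 0.\<close>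
    have "word_binom [0::nat, 1] [0, 1] \<noteq> word_binom [1::nat, 0] [0, 1]" by simp
    then show "\<not> binom_equiv (Suc (Suc 0)) (u_seq 0 @ [0] @ [1]) (u_seq 0 @ [1] @ [0])"
      unfolding binom_equiv_append_left_iff
      using binom_equivD[of "Suc (Suc 0)" "[0::nat] @ [1]" "[1] @ [0]" "[0, 1]"] by auto
  qed
next
  case (Suc k)
  then obtain v w where vw: "v \<in> D_seq (Suc k)" "w \<in> D_seq (Suc k)"
      "binom_equiv (Suc k) v w" "\<not> binom_equiv (Suc (Suc k)) v w" by blast
  show ?case
  proof (intro bexI conjI)
    show "u_seq (Suc k) @ w @ v \<in> D_seq (Suc (Suc k))" "u_seq (Suc k) @ v @ w \<in> D_seq (Suc (Suc k))"
      using vw by (simp_all add: D_seq_SucI)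
    have "v \<noteq> []" using D_seq_length_gt[OF vw(1)] by auto
    then show "\<not> binom_equiv (Suc (Suc (Suc k))) (u_seq (Suc k) @ v @ w) (u_seq (Suc k) @ w @ v)"
      unfolding binom_equiv_append_left_iff using vw by (intro not_binom_equiv_commute) auto
    show "binom_equiv (Suc (Suc k)) (u_seq (Suc k) @ v @ w) (u_seq (Suc k) @ w @ v)"
      unfolding binom_equiv_append_left_iff using vw by (intro binom_equiv_commute)
  qed
qed

text \<open>The diagonal pair lives at level \<open>k\<close>; further steps raise the level while
  keeping the order.\<close>

lemma D_seq_binom_pair:
  assumes "1 \<le> k" "k \<le> j"
  shows "\<exists>v\<in>D_seq j. \<exists>w\<in>D_seq j. binom_equiv k v w \<and> \<not> binom_equiv (Suc k) v w"
  using assms(2)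
proof (induction j rule: dec_induct)
  case base
  show ?case using D_seq_binom_pair_diagonal[of "k - 1"] \<open>1 \<le> k\<close> by simp
next
  case (step j)
  then show ?case using D_seq_binom_pair_step by blast
qed

section \<open>Counts of ones and the first letters of the limit\<close>

lemma D_seq_counts: "\<exists>c. {c..c + Suc j} \<subseteq> (\<lambda>w. count_list w 1) ` D_seq j"
proof (induction j)
  case 0
  have "{0..Suc 0} \<subseteq> (\<lambda>w. count_list w 1) ` D_seq 0" by (auto simp: image_iff le_Suc_eq)
  then show ?case by (metis add_0)
next
  case (Suc j)
  then obtain c where c: "{c..c + Suc j} \<subseteq> (\<lambda>w. count_list w 1) ` D_seq j" by blast
  let ?c = "count_list (u_seq j) 1 + c + c"
  have "m \<in> (\<lambda>w. count_list w 1) ` D_seq (Suc j)" if "m \<in> {?c..?c + Suc (Suc j)}" for m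
  proof -
    \<comment> \<open>With \<open>b = c\<close> fixed, \<open>a\<close> reaches every value but the
      largest; that one takes \<open>b = c + 1\<close> and the maximal \<open>a\<close>.\<close>
    define b where "b = (if m = ?c + Suc (Suc j) then c + 1 else c)"
    define a where "a = m - count_list (u_seq j) 1 - b"
    have ab: "m = count_list (u_seq j) 1 + a + b" "a \<in> {c..c + Suc j}" "b \<in> {c..c + Suc j}"
      using that by (auto simp: a_def b_def)
    then have "a \<in> (\<lambda>w. count_list w 1) ` D_seq j" "b \<in> (\<lambda>w. count_list w 1) ` D_seq j"
      using c by blast+
    then obtain v w where "v \<in> D_seq j" "w \<in> D_seq j" "count_list v 1 = a" "count_list w 1 = b"
      by blast
    then show ?thesis
      using ab(1) by (intro image_eqI[of _ _ "u_seq j @ v @ w"] D_seq_SucI) auto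
  qed
  then show ?case by blast
qed

lemma u_lim_prefix_16: "u_lim [0 \<rightarrow> 16] = [0,1,0,0, 0,1,0,1, 0,1,1,0, 0,1,1,1]"
proof -
  have u0: "u_seq 0 = [0, 1]" by (simp add: u_seq_def lex_concat_def)
  have "D_seq 1 = set [[0,1,0,0], [0,1,0,1], [0,1,1,0], [0,1,1,1]]"
  proof -
    have "D_seq 1 = (\<lambda>(w1, w2). [0, 1] @ w1 @ w2) ` (D_seq 0 \<times> D_seq 0)"
      unfolding One_nat_def D_seq_Suc u0 by (auto simp del: D_seq.simps)
    then show ?thesis by (simp add: Sigma_def insert_commute)
  qed
  moreover have "sorted_list_of_set (set [[0,1,0,0], [0,1,0,1], [0,1,1,0], [0,1,1,1]])
      = [[0,1,0,0], [0,1,0,1], [0,1,1,0], [0,1,1,1::nat]]"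
    by (rule sorted_list_of_set.idem_if_sorted_distinct) simp_all
  ultimately have u1: "u_seq 1 = [0,1,0,0, 0,1,0,1, 0,1,1,0, 0,1,1,1]"
    by (simp add: u_seq_def lex_concat_def)
  have "length (u_seq 1) = 16" unfolding u1 by simp
  then show ?thesis using u_seq_eq_prefix_u_lim[of 1] u1 by metis
qed

theorem theorem6p4:
  shows "words_converge u_seq u_lim \<and>
         u_lim [0 \<rightarrow> 16] = [0,1,0,0, 0,1,0,1, 0,1,1,0, 0,1,1,1] \<and>
         \<not> bdd_above (range (abelian_complexity u_lim)) \<and>
         (\<forall>k\<ge>1. binom_complexity k u_lim \<prec> binom_complexity (k + 1) u_lim)"
proof (intro conjI allI impI words_converge_u_lim u_lim_prefix_16)
  have "\<exists>n. B < abelian_complexity u_lim n" for B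
  proof -
    obtain c where c: "{c..c + Suc B} \<subseteq> (\<lambda>w. count_list w 1) ` D_seq B"
      using D_seq_counts by blast
    obtain v where v: "v \<in> D_seq B" using D_seq_nonempty by blast
    have "D_seq B \<subseteq> factors u_lim (length v)"
      using D_seq_subset_factors D_seq_length_eq[OF v] by auto
    then have "{c..c + Suc B} \<subseteq> (\<lambda>w. count_list w 1) ` factors u_lim (length v)"
      using c by blast
    \<comment> \<open>The interval has \<open>B + 2\<close> elements.\<close>
    from abelian_complexity_ge[OF finite_range_u_lim this]
    have "B < abelian_complexity u_lim (length v)" by simp
    then show ?thesis ..
  qed
  then show "\<not> bdd_above (range (abelian_complexity u_lim))"
    unfolding bdd_above_def by (meson not_le rangeI)
next
  fix k :: nat assume "1 \<le> k"
  have "\<exists>n>m. binom_complexity k u_lim n < binom_complexity (k + 1) u_lim n" for m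
  proof -
    \<comment> \<open>Level \<open>k + m\<close> is at least \<open>k\<close>, so a pair of order
      \<open>k\<close> exists, and its words are longer than \<open>m\<close>.\<close>
    obtain v w where vw: "v \<in> D_seq (k + m)" "w \<in> D_seq (k + m)"
        "binom_equiv k v w" "\<not> binom_equiv (Suc k) v w"
      using D_seq_binom_pair[OF \<open>1 \<le> k\<close>, of "k + m"] by auto
    have "v \<in> factors u_lim (length v)" "w \<in> factors u_lim (length v)"
      using vw D_seq_subset_factors[of v "k + m"] D_seq_subset_factors[of w "k + m"]
        D_seq_length_eq[of v "k + m" w] by simp_all
    then have "binom_complexity k u_lim (length v) < binom_complexity (k + 1) u_lim (length v)"
      using binom_complexity_less[OF finite_range_u_lim] vw by simp
    moreover have "m < length v" using D_seq_length_gt[OF vw(1)] by simp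
    ultimately show ?thesis by blast
  qed
  then show "binom_complexity k u_lim \<prec> binom_complexity (k + 1) u_lim"
    by (simp add: inf_often_less_def infinite_nat_iff_unbounded)
qed

end
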